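(* There is an absolute constant $c>0$ such that for all integers $k\ge 2$ and $n\ge 3k$, every deterministic streaming algorithm that computes $\mathsf{ApproxCount}_{k\text{-counter}}\!\left[n,\frac{n}{3(k-1)}\right]$ uses at least $c\,k\log(n/k)$ bits of space.
   Context: For integers $k\ge2$, $n\ge1$ and real $\Delta\ge0$, $\mathsf{ApproxCount}_{k\text{-counter}}[n,\Delta]$ is the following problem: on input $x=(x_1,\dots,x_n)\in[k]^n$, output a tuple of reals $(\hat S_1,\dots,\hat S_k)$ with $|\hat S_j-\#\{i\in[n]: x_i=j\}|\le\Delta$ for every $j\in[k]$; an algorithm computes the problem if its output is valid on every input (deterministic, worst case). A deterministic streaming algorithm using $s$ bits of space reads $x_1,\dots,x_n$ one symbol at a time; after each prefix it is in one of at most $2^s$ memory states, the next state is an arbitrary function of the time index, the current state and the next symbol, and the final output is an arbitrary function of the final state. (Equivalently, it is a read-once branching program of width at most $2^s$.) *)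

theory Defs
  imports Complex_Main
begin

text \<open>
  Inputs \<open>x \<in> [k]\<^sup>n\<close> are lists over \<open>{1..k}\<close>, with \<open>x ! t\<close> the symbol read at time \<open>t < n\<close>.
  Output tuples are functions \<open>nat \<Rightarrow> real\<close>, of which only the values on \<open>{1..k}\<close> matter.
\<close>

definition inputs :: "nat \<Rightarrow> nat \<Rightarrow> nat list set" where
  "inputs k n = {x. length x = n \<and> set x \<subseteq> {1..k}}"

definition approx_count_valid :: "nat \<Rightarrow> real \<Rightarrow> nat list \<Rightarrow> (nat \<Rightarrow> real) \<Rightarrow> bool" where
  "approx_count_valid k \<Delta> x S \<longleftrightarrow>
     (\<forall>j\<in>{1..k}. \<bar>S j - real (card {i. i < length x \<and> x ! i = j})\<bar> \<le> \<Delta>)"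

text \<open>
  \<open>states A t\<close> is the set of memory states available after a prefix of length \<open>t\<close>, that is,
  layer \<open>t\<close> of the corresponding read-once branching program.
\<close>

record 'q stream_alg =
  states :: "nat \<Rightarrow> 'q set"
  start :: 'q
  step :: "nat \<Rightarrow> 'q \<Rightarrow> nat \<Rightarrow> 'q"
  result :: "'q \<Rightarrow> nat \<Rightarrow> real"

definition streaming_algorithm :: "nat \<Rightarrow> nat \<Rightarrow> 'q stream_alg \<Rightarrow> bool" where
  "streaming_algorithm k n A \<longleftrightarrow>
     start A \<in> states A 0 \<and>
     (\<forall>t<n. \<forall>q\<in>states A t. \<forall>a\<in>{1..k}. step A t q a \<in> states A (Suc t))"

definition uses_space :: "nat \<Rightarrow> 'q stream_alg \<Rightarrow> nat \<Rightarrow> bool" where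
  "uses_space n A s \<longleftrightarrow> (\<forall>t\<le>n. finite (states A t) \<and> card (states A t) \<le> 2 ^ s)"

primrec state_after :: "'q stream_alg \<Rightarrow> nat list \<Rightarrow> nat \<Rightarrow> 'q" where
  "state_after A x 0 = start A"
| "state_after A x (Suc t) = step A t (state_after A x t) (x ! t)"

definition computes_approx_count :: "nat \<Rightarrow> nat \<Rightarrow> real \<Rightarrow> 'q stream_alg \<Rightarrow> bool" where
  "computes_approx_count k n \<Delta> A \<longleftrightarrow>
     (\<forall>x\<in>inputs k n. approx_count_valid k \<Delta> x (result A (state_after A x n)))"

text \<open>
  Lower bounds with an absolute constant are stated for \<open>nat stream_alg\<close>: a type variable for
  the states would be quantified outside the constant. This loses nothing, since the layers are
  finite and can be renamed to sets of natural numbers.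
\<close>

end

theory Submission
  imports Defs
begin

text \<open>
  Call a point \<open>p \<in> \<nat>\<^sup>k\<close> dominating at time \<open>t\<close> if some state \<open>q\<close> is reached, for every symbol
  \<open>j\<close>, by an input containing at most \<open>p\<^sub>j\<close> copies of \<open>j\<close> (the input may depend on \<open>j\<close>), and let
  \<open>U\<^sub>t\<close> be the up-set of these points. Reading \<open>j\<close> gives \<open>U\<^sub>t + e\<^sub>j \<subseteq> U\<^sub>t\<^sub>+\<^sub>1\<close>, so a point of
  \<open>U\<^sub>t\<close> outside \<open>U\<^sub>t\<^sub>+\<^sub>1\<close> is a minimal element of \<open>U\<^sub>t\<close>, and \<open>U\<^sub>t\<close> has at most one minimal
  element per state. As \<open>U\<^sub>0 = \<nat>\<^sup>k\<close>, at most \<open>n 2\<^sup>s\<close> points lie outside \<open>U\<^sub>n\<close>. The accuracy of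
  the output forces \<open>\<Sum> p\<^sub>j \<ge> n/3\<close> on \<open>U\<^sub>n\<close>, so the whole simplex \<open>\<Sum> p\<^sub>j < n/3\<close> is lost, and it
  has about \<open>(n/k)\<^sup>k\<close> points.
\<close>

text \<open>Coordinate \<open>i\<close> of a point, counted from \<open>0\<close>, belongs to the symbol \<open>Suc i\<close>.\<close>

definition dominating_points :: "nat \<Rightarrow> 'q stream_alg \<Rightarrow> nat \<Rightarrow> nat list set" where
  "dominating_points k A t = {p. length p = k \<and> (\<exists>q\<in>states A t. \<forall>i<k. \<exists>x\<in>inputs k t.
     state_after A x t = q \<and> count_list x (Suc i) \<le> p ! i)}"

section \<open>Counts and states along an input\<close>

lemma card_nth_eq_count_list: "card {i. i < length x \<and> x ! i = j} = count_list x j"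
  by (auto simp: count_list_eq_length_filter length_filter_conv_card intro!: arg_cong[where f = card])

lemma state_after_append: "t \<le> length x \<Longrightarrow> state_after A (x @ y) t = state_after A x t"
  by (induction t) (auto simp: nth_append)

lemma state_after_in_states:
  assumes "streaming_algorithm k n A" "x \<in> inputs k n" "t \<le> n"
  shows "state_after A x t \<in> states A t"
  using assms(3)
proof (induction t)
  case 0
  then show ?case using assms(1) by (simp add: streaming_algorithm_def)
next
  case (Suc t)
  then have "x ! t \<in> {1..k}" using assms(2) nth_mem[of t x] by (auto simp: inputs_def simp del: nth_mem)
  with Suc assms(1) show ?case by (simp add: streaming_algorithm_def)
qed

lemma sum_count_list_inputs:
  assumes "x \<in> inputs k n"
  shows "(\<Sum>i<k. count_list x (Suc i)) = n"
proof -
  have "(\<Sum>i<k. count_list x (Suc i)) = (\<Sum>j\<in>{1..k}. count_list x j)"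
    by (rule sum.reindex_bij_witness[of _ "\<lambda>j. j - 1" Suc]) auto
  also have "\<dots> = (\<Sum>j\<in>set x. count_list x j)"
    using assms by (intro sum.mono_neutral_right) (auto simp: inputs_def count_list_0_iff)
  also have "\<dots> = n"
    using assms by (simp add: inputs_def sum_count_set)
  finally show ?thesis .
qed

section \<open>Evolution and loss of dominating points\<close>

lemma dominating_points_0:
  assumes "streaming_algorithm k n A"
  shows "dominating_points k A 0 = {p. length p = k}"
  using assms by (auto simp: dominating_points_def streaming_algorithm_def inputs_def)

text \<open>All witnesses share the state \<open>q\<close>, so appending the same symbol keeps them
  together; only the count of \<open>Suc i\<close> grows, and the raised coordinate absorbs
  that.\<close>

lemma dominating_points_Suc:
  assumes alg: "streaming_algorithm k n A" and "t < n" and "p \<in> dominating_points k A t" and "i < k"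
  shows "p[i := Suc (p ! i)] \<in> dominating_points k A (Suc t)"
proof -
  from assms(3) obtain q where len: "length p = k" and q: "q \<in> states A t"
    and x: "\<And>j. j < k \<Longrightarrow> \<exists>x\<in>inputs k t. state_after A x t = q \<and> count_list x (Suc j) \<le> p ! j"
    by (auto simp: dominating_points_def)
  have "step A t q (Suc i) \<in> states A (Suc t)"
    using alg \<open>t < n\<close> q \<open>i < k\<close> by (simp add: streaming_algorithm_def)
  moreover have "\<exists>x\<in>inputs k (Suc t). state_after A x (Suc t) = step A t q (Suc i) \<and>
      count_list x (Suc j) \<le> p[i := Suc (p ! i)] ! j" if "j < k" for j
  proof -
    from x[OF that] obtain x where x: "x \<in> inputs k t" "state_after A x t = q"
      "count_list x (Suc j) \<le> p ! j" by blast
    then have "x @ [Suc i] \<in> inputs k (Suc t)" "length x = t"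
      using \<open>i < k\<close> by (auto simp: inputs_def)
    moreover have "state_after A (x @ [Suc i]) (Suc t) = step A t q (Suc i)"
      using x \<open>length x = t\<close> by (simp add: state_after_append nth_append)
    moreover have "count_list (x @ [Suc i]) (Suc j) \<le> p[i := Suc (p ! i)] ! j"
      using x(3) that len by (auto simp: nth_list_update)
    ultimately show ?thesis by blast
  qed
  ultimately show ?thesis using len by (auto simp: dominating_points_def)
qed

text \<open>A lost point is the least point witnessed by any of its states, so a state determines it
  and choosing a state for each lost point is injective.\<close>

lemma lost_dominating_points:
  assumes alg: "streaming_algorithm k n A" and "t < n" and fin: "finite (states A t)"
  shows "finite (dominating_points k A t - dominating_points k A (Suc t))"
    and "card (dominating_points k A t - dominating_points k A (Suc t)) \<le> card (states A t)"
proof -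
  let ?L = "dominating_points k A t - dominating_points k A (Suc t)"
  define R where "R p q \<longleftrightarrow> q \<in> states A t \<and> (\<forall>i<k. \<exists>x\<in>inputs k t.
     state_after A x t = q \<and> count_list x (Suc i) \<le> p ! i)" for p :: "nat list" and q
  have pts: "p \<in> dominating_points k A t \<longleftrightarrow> length p = k \<and> (\<exists>q. R p q)" for p
    by (auto simp: dominating_points_def R_def)
  have le: "p ! i \<le> p' ! i" if p: "p \<in> ?L" "R p q" and p': "R p' q" and i: "i < k" for p p' q i
  proof (rule ccontr)
    assume "\<not> p ! i \<le> p' ! i"
    then have lt: "p' ! i \<le> p ! i - 1" "p ! i > 0" by auto
    have len: "length p = k" using p pts by simp
    \<comment> \<open>\<open>q\<close> also witnesses the lowered point: borrow the input for
      \<open>Suc i\<close> from \<open>p'\<close> and keep the others from \<open>p\<close>. Reading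
      \<open>Suc i\<close> would then restore \<open>p\<close>, which was lost.\<close>
    let ?p = "p[i := p ! i - 1]"
    have "R ?p q"
      unfolding R_def
    proof (intro conjI allI impI)
      show "q \<in> states A t" using p by (simp add: R_def)
      fix j assume j: "j < k"
      show "\<exists>x\<in>inputs k t. state_after A x t = q \<and> count_list x (Suc j) \<le> ?p ! j"
      proof (cases "j = i")
        case True
        from p' i obtain x where "x \<in> inputs k t" "state_after A x t = q" "count_list x (Suc i) \<le> p' ! i"
          unfolding R_def by blast
        then show ?thesis using True i lt len by (intro bexI[of _ x]) auto
      next
        case False
        then show ?thesis using p j unfolding R_def by simp
      qed
    qed
    then have "?p \<in> dominating_points k A t" using len pts by auto
    from dominating_points_Suc[OF alg \<open>t < n\<close> this i] have "p \<in> dominating_points k A (Suc t)"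
      using lt len i by simp
    with p show False by simp
  qed
  define f where "f p = (SOME q. R p q)" for p
  have f: "R p (f p)" if "p \<in> ?L" for p
    using that pts unfolding f_def by (metis DiffD1 someI)
  have inj: "inj_on f ?L"
  proof (rule inj_onI)
    fix p p' assume p: "p \<in> ?L" "p' \<in> ?L" "f p = f p'"
    have "length p = k" "length p' = k" using p pts by auto
    moreover have "p ! i = p' ! i" if "i < k" for i
    proof (rule le_antisym)
      show "p ! i \<le> p' ! i" using p(1) f[OF p(1)] f[OF p(2), folded p(3)] that by (rule le)
      show "p' ! i \<le> p ! i" using p(2) f[OF p(2)] f[OF p(1), unfolded p(3)] that by (rule le)
    qed
    ultimately show "p = p'" by (simp add: list_eq_iff_nth_eq)
  qed
  have sub: "f ` ?L \<subseteq> states A t" using f by (auto simp: R_def)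
  show "finite ?L" by (rule inj_on_finite[OF inj sub fin])
  show "card ?L \<le> card (states A t)" by (rule card_inj_on_le[OF inj sub fin])
qed

lemma card_not_dominating_le:
  assumes alg: "streaming_algorithm k n A" and space: "uses_space n A s"
  shows "finite ({p. length p = k} - dominating_points k A n)"
    and "card ({p. length p = k} - dominating_points k A n) \<le> n * 2 ^ s"
proof -
  let ?L = "\<lambda>t. dominating_points k A t - dominating_points k A (Suc t)"
  have st: "finite (states A t)" "card (states A t) \<le> 2 ^ s" if "t < n" for t
    using space that by (auto simp: uses_space_def)
  have sub: "{p. length p = k} - dominating_points k A m \<subseteq> (\<Union>t<m. ?L t)" for m
  proof (induction m)
    case 0
    then show ?case by (simp add: dominating_points_0[OF alg])
  next
    case (Suc m)
    have "dominating_points k A t \<subseteq> {p. length p = k}" for t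
      by (auto simp: dominating_points_def)
    with Suc show ?case unfolding lessThan_Suc by blast
  qed
  have fin: "finite (\<Union>t<n. ?L t)"
    using lost_dominating_points(1)[OF alg] st by auto
  show "finite ({p. length p = k} - dominating_points k A n)"
    using fin sub by (rule rev_finite_subset)
  have "card ({p. length p = k} - dominating_points k A n) \<le> card (\<Union>t<n. ?L t)"
    using fin sub by (rule card_mono)
  also have "\<dots> \<le> (\<Sum>t<n. card (?L t))" by (rule card_UN_le) simp
  also have "\<dots> \<le> (\<Sum>t<n. 2 ^ s)"
    using lost_dominating_points(2)[OF alg] st by (intro sum_mono) (force intro: le_trans)
  finally show "card ({p. length p = k} - dominating_points k A n) \<le> n * 2 ^ s" by simp
qed

text \<open>
  The input witnessing the first coordinate needs no error term there, so the error \<open>2 \<Delta>\<close> is paid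
  for only \<open>k - 1\<close> symbols.
\<close>

lemma sum_list_dominating_ge:
  assumes comp: "computes_approx_count k n \<Delta> A" and "k > 0" and "p \<in> dominating_points k A n"
  shows "real n \<le> real (sum_list p) + 2 * \<Delta> * (real k - 1)"
proof -
  from assms(3) obtain q where len: "length p = k"
    and q: "\<And>i. i < k \<Longrightarrow> \<exists>x\<in>inputs k n. state_after A x n = q \<and> count_list x (Suc i) \<le> p ! i"
    by (auto simp: dominating_points_def)
  have valid: "\<bar>result A q (Suc i) - real (count_list x (Suc i))\<bar> \<le> \<Delta>"
    if "x \<in> inputs k n" "state_after A x n = q" "i < k" for x i
    using comp that
    by (auto simp: computes_approx_count_def approx_count_valid_def card_nth_eq_count_list)
  from q[OF \<open>k > 0\<close>] obtain x where x: "x \<in> inputs k n" "state_after A x n = q"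
    "count_list x 1 \<le> p ! 0" by auto
  have le: "real (count_list x (Suc i)) \<le> real (p ! i) + 2 * \<Delta>" if "i < k" for i
  proof -
    from q[OF that] obtain y where "y \<in> inputs k n" "state_after A y n = q"
      "count_list y (Suc i) \<le> p ! i" by blast
    with valid[of y i] valid[OF x(1,2) that] that show ?thesis by simp
  qed
  have split: "{..<k} = insert 0 {1..<k}" using \<open>k > 0\<close> by auto
  have "real n = (\<Sum>i<k. real (count_list x (Suc i)))"
    using sum_count_list_inputs[OF x(1)] by (metis of_nat_sum)
  also have "\<dots> \<le> real (p ! 0) + (\<Sum>i=1..<k. real (p ! i) + 2 * \<Delta>)"
    unfolding split using x(3) le by (auto intro!: add_mono sum_mono)
  also have "\<dots> = (\<Sum>i<k. real (p ! i)) + 2 * \<Delta> * (real k - 1)"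
    unfolding split using \<open>k > 0\<close> by (simp add: sum.distrib of_nat_diff algebra_simps)
  also have "(\<Sum>i<k. real (p ! i)) = real (sum_list p)"
    by (simp add: sum_list_sum_nth len atLeast0LessThan)
  finally show ?thesis .
qed

text \<open>Prepending the slack \<open>M - \<Sum> l\<close> turns the inequality into an equation with \<open>k + 1\<close> summands.\<close>

lemma card_sum_list_le_ge:
  assumes "finite {l :: nat list. length l = k \<and> sum_list l \<le> M}"
  shows "(M + k) choose k \<le> card {l :: nat list. length l = k \<and> sum_list l \<le> M}"
proof -
  let ?E = "{l :: nat list. length l = Suc k \<and> sum_list l = M}"
  have "inj_on tl ?E"
  proof (rule inj_onI)
    fix l l' assume "l \<in> ?E" "l' \<in> ?E" "tl l = tl l'"
    then show "l = l'" by (cases l; cases l') auto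
  qed
  moreover have "tl ` ?E \<subseteq> {l. length l = k \<and> sum_list l \<le> M}"
  proof (rule image_subsetI)
    fix l assume "l \<in> ?E"
    then show "tl l \<in> {l. length l = k \<and> sum_list l \<le> M}" by (cases l) auto
  qed
  ultimately have "card ?E \<le> card {l :: nat list. length l = k \<and> sum_list l \<le> M}"
    using assms by (rule card_inj_on_le)
  then show ?thesis
    using card_length_sum_list[of "Suc k" M] binomial_symmetric[of M "M + k"] by simp
qed

lemma binomial_le_states:
  assumes alg: "streaming_algorithm k n A" "uses_space n A s"
    and comp: "computes_approx_count k n (real n / (3 * (real k - 1))) A"
    and "k \<ge> 2" "3 * M < n"
  shows "(M + k) choose k \<le> n * 2 ^ s"
proof -
  let ?P = "{p :: nat list. length p = k \<and> sum_list p \<le> M}"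
  have "p \<notin> dominating_points k A n" if "p \<in> ?P" for p
  proof
    assume "p \<in> dominating_points k A n"
    with comp \<open>k \<ge> 2\<close> have "real n \<le> real (sum_list p) + 2 * (real n / (3 * (real k - 1))) * (real k - 1)"
      by (intro sum_list_dominating_ge) auto
    \<comment> \<open>The \<open>k - 1\<close> in the accuracy cancels the number of symbols that
      pay an error.\<close>
    also have "2 * (real n / (3 * (real k - 1))) * (real k - 1) = 2 * real n / 3"
      using \<open>k \<ge> 2\<close> by (simp add: divide_simps)
    finally have "real n \<le> 3 * real (sum_list p)" by simp
    with that \<open>3 * M < n\<close> show False by auto
  qed
  then have sub: "?P \<subseteq> {p. length p = k} - dominating_points k A n" by auto
  note lost = card_not_dominating_le[OF alg]
  have "(M + k) choose k \<le> card ?P"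
    using finite_subset[OF sub lost(1)] by (rule card_sum_list_le_ge)
  also have "\<dots> \<le> n * 2 ^ s"
    using card_mono[OF lost(1) sub] lost(2) by simp
  finally show ?thesis .
qed

text \<open>Serves to absorb an additive constant in \<open>log_bound_from_power\<close>. With a
  single state, two constant inputs share an output although their counts of 1 differ by
  \<open>n\<close>, more than twice the allowed error.\<close>

lemma space_pos:
  assumes alg: "streaming_algorithm k n A" and space: "uses_space n A s"
    and comp: "computes_approx_count k n (real n / (3 * (real k - 1))) A"
    and "k \<ge> 2" "n > 0"
  shows "s > 0"
proof (rule ccontr)
  assume "\<not> s > 0"
  define x y where "x = replicate n (1::nat)" and "y = replicate n (2::nat)"
  have xy: "x \<in> inputs k n" "y \<in> inputs k n"
    using \<open>k \<ge> 2\<close> by (auto simp: x_def y_def inputs_def)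
  have "finite (states A n)" "card (states A n) \<le> Suc 0"
    using space \<open>\<not> s > 0\<close> by (auto simp: uses_space_def)
  then have eq: "state_after A x n = state_after A y n"
    using state_after_in_states[OF alg] xy by (auto simp: card_le_Suc0_iff_eq)
  let ?S = "result A (state_after A x n) 1" and ?\<Delta> = "real n / (3 * (real k - 1))"
  have cnt: "count_list (replicate n a) b = (if a = b then n else 0)" for a b :: nat
    by (induction n) auto
  have "\<bar>?S - real (count_list x 1)\<bar> \<le> ?\<Delta>" "\<bar>?S - real (count_list y 1)\<bar> \<le> ?\<Delta>"
    using comp xy eq \<open>k \<ge> 2\<close>
    by (auto simp: computes_approx_count_def approx_count_valid_def card_nth_eq_count_list)
  then have "real n \<le> 2 * ?\<Delta>" by (simp add: x_def y_def cnt)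
  moreover have "?\<Delta> \<le> real n / 3"
    using \<open>k \<ge> 2\<close> by (intro divide_left_mono) auto
  ultimately show False using \<open>n > 0\<close> by simp
qed

section \<open>Numerical estimates and conclusion\<close>

text \<open>Combines \<open>k * (N choose k) = N * ((N - 1) choose (k - 1))\<close> with the bound
  \<open>(N / j) ^ j\<close> for \<open>N choose j\<close>. The factor \<open>m\<close> in front
  later cancels the number of time steps.\<close>

lemma power_le_binomial:
  fixes k m :: nat
  assumes "k \<ge> 2" "m \<ge> k"
  shows "real m * (1 + real m / real k) ^ (k - 1) \<le> real k * real ((m - 1 + k) choose k)"
proof -
  obtain j where k: "k = Suc j" and "j > 0" using assms by (cases k) auto
  \<comment> \<open>\<open>m / k\<close> is at most \<open>(m - 1) / (k - 1)\<close> because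
    \<open>k\<close> is at most \<open>m\<close>.\<close>
  have "1 + real m / real k \<le> real (m - 1 + j) / real j"
    using assms \<open>j > 0\<close> by (simp add: k field_simps of_nat_diff)
  then have "(1 + real m / real k) ^ j \<le> (real (m - 1 + j) / real j) ^ j"
    by (intro power_mono) auto
  also have "\<dots> \<le> real ((m - 1 + j) choose j)"
    using binomial_ge_n_over_k_pow_k[of j "m - 1 + j"] by simp
  finally have "real m * (1 + real m / real k) ^ j \<le> real (m + j) * real ((m - 1 + j) choose j)"
    by (intro mult_mono) auto
  also have "\<dots> = real (Suc (m - 1 + j) * ((m - 1 + j) choose j))"
    using assms by (simp only: of_nat_mult flip: k) (simp add: k)
  also have "\<dots> = real k * real ((m - 1 + k) choose k)"
    unfolding Suc_times_binomial_eq k by (simp only: of_nat_mult mult.commute add_Suc_right)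
  finally show ?thesis by (simp add: k)
qed

lemma log_bound_from_power:
  fixes r :: real and k s :: nat
  assumes "r \<ge> 3" "k \<ge> 2" "s > 0" and bound: "(1 + r / 3) ^ (k - 1) \<le> 3 * real k * 2 ^ s"
  shows "real s \<ge> 1 / 48 * real k * log 2 r"
proof -
  define L where "L = log 2 r"
  have L: "L \<ge> 1" using assms(1) by (simp add: L_def le_log_iff)
  \<comment> \<open>\<open>(1 + r / 3)\<^sup>2 - r\<close> equals this square plus 3/4.\<close>
  have "0 \<le> (r / 3 - 1 / 2)\<^sup>2" by simp
  then have "r \<le> (1 + r / 3)\<^sup>2"
    using assms(1) by (simp add: power2_eq_square field_simps)
  then have "L \<le> 2 * log 2 (1 + r / 3)"
    using assms(1) log_le_cancel_iff[of 2 r "(1 + r / 3)\<^sup>2"] by (simp add: L_def log_nat_power)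
  then have "(real k - 1) * (L / 2) \<le> (real k - 1) * log 2 (1 + r / 3)"
    using assms(2) by (intro mult_left_mono) auto
  also have "\<dots> = log 2 ((1 + r / 3) ^ (k - 1))"
    using assms(1,2) by (simp add: log_nat_power of_nat_diff)
  also have "\<dots> \<le> log 2 (3 * real k * 2 ^ s)"
    using assms(1,2) bound by (intro log_mono) (auto intro!: zero_less_power add_pos_pos)
  also have "\<dots> = log 2 (3 * real k) + real s"
    using assms(2) by (simp add: log_mult log_nat_power)
  \<comment> \<open>Slope 1/4 keeps this term below half of the left side, as \<open>L\<close> is at
    least 1; the 5 is the logarithm of 32.\<close>
  also have "log 2 (3 * real k) \<le> 5 + (real k - 1) / 4"
  proof -
    have "real k / 8 \<le> 1 + (real k - 1) / 4 * ln 2"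
    proof -
      have "1 / 2 \<le> ln (2::real)"
        using ln_le_minus_one[of "1 / 2"] by (simp add: ln_div)
      then have "(real k - 1) / 4 * (1 / 2) \<le> (real k - 1) / 4 * ln (2::real)"
        using assms(2) by (intro mult_left_mono) auto
      then show ?thesis by simp
    qed
    also have "\<dots> \<le> 2 powr ((real k - 1) / 4)"
      unfolding powr_def using exp_ge_add_one_self by simp
    finally have "3 * real k \<le> 2 powr 5 * 2 powr ((real k - 1) / 4)"
      by simp
    then show ?thesis
      using assms(2) by (simp add: log_le_iff powr_add)
  qed
  finally have "(real k - 1) * (L / 2) \<le> 5 + (real k - 1) / 4 + real s" by simp
  moreover define X where "X = (real k - 1) * L"
  ultimately have "X / 2 \<le> 5 + (real k - 1) / 4 + real s" by simp
  moreover have "real k - 1 \<le> X" "L \<le> X"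
    using assms(2) L by (simp_all add: X_def)
  \<comment> \<open>The first bound on \<open>X\<close> leaves \<open>X / 4 \<le> 5 + s\<close>, the
    second gives \<open>X + L \<le> 2 * X\<close>. Since \<open>X + L = k * L\<close> and
    \<open>5 + s \<le> 6 * s\<close>, the constant is 1/(8 * 6).\<close>
  ultimately have "X + L \<le> 40 + 8 * real s" by (simp add: field_simps)
  then have "real k * L / 8 \<le> 5 + real s"
    by (simp add: X_def algebra_simps)
  with \<open>s > 0\<close> have "real k * L / 8 \<le> 6 * real s" by simp
  then show ?thesis by (simp add: L_def)
qed

theorem theorem1p1:
  "\<exists>c>0::real. \<forall>(k::nat) (n::nat) (A::nat stream_alg) (s::nat).
     k \<ge> 2 \<and> n \<ge> 3 * k \<and>
     streaming_algorithm k n A \<and> uses_space n A s \<and>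
     computes_approx_count k n (real n / (3 * (real k - 1))) A \<longrightarrow>
     real s \<ge> c * real k * log 2 (real n / real k)"
proof (intro exI[of _ "1 / 48"] conjI allI impI; (elim conjE)?)
  fix k n s :: nat and A :: "nat stream_alg"
  assume k: "k \<ge> 2" and n: "n \<ge> 3 * k" and alg: "streaming_algorithm k n A" "uses_space n A s"
    and comp: "computes_approx_count k n (real n / (3 * (real k - 1))) A"
  \<comment> \<open>This is \<open>n / 3\<close> rounded up, so \<open>m - 1\<close> is the largest
    \<open>M\<close> with \<open>3 * M < n\<close>.\<close>
  define m where "m = (n + 2) div 3"
  have m: "3 * (m - 1) < n" "n \<le> 3 * m" "m \<ge> k" "m > 0"
    using k n by (auto simp: m_def)
  have "real m * (1 + real m / real k) ^ (k - 1) \<le> real k * real ((m - 1 + k) choose k)"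
    using k m(3) by (rule power_le_binomial)
  also have "\<dots> \<le> real k * (real n * 2 ^ s)"
    using of_nat_mono[OF binomial_le_states[OF alg comp k m(1)], where ?'a = real]
    by (intro mult_left_mono) auto
  also have "\<dots> \<le> real k * (3 * real m * 2 ^ s)"
    using m(2) by (intro mult_left_mono mult_right_mono) auto
  finally have "(1 + real m / real k) ^ (k - 1) \<le> 3 * real k * 2 ^ s"
    using m(4) by (simp add: mult_ac)
  moreover have "(1 + real n / real k / 3) ^ (k - 1) \<le> (1 + real m / real k) ^ (k - 1)"
    using m(2) k by (intro power_mono) (auto simp: field_simps)
  ultimately have "(1 + real n / real k / 3) ^ (k - 1) \<le> 3 * real k * 2 ^ s"
    by linarith
  moreover have "real n / real k \<ge> 3"
    using n k by (simp add: field_simps)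
  moreover have "s > 0"
    using space_pos[OF alg comp k] n k by simp
  ultimately show "real s \<ge> 1 / 48 * real k * log 2 (real n / real k)"
    using k by (intro log_bound_from_power) auto
qed simp

end
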